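(* Let $\gamma(s)$ be a null curve in $E_1^4$ with Frenet vector fields $F_1,F_2,F_3,F_4$. The canal hypersurfaces that are formed as the envelope of a family of pseudo hyperspheres with radius function $r(s)$ whose centers lie on $\gamma(s)$ can be parametrized by $$C_1(s,t,w)=\gamma(s)+a_1(s,t,w)F_1(s)+a_2(s,t,w)F_2(s)-r(s)r'(s)F_3(s)+a_4(s,t,w)F_4(s),$$ where $a_2(s,t,w)^2+a_4(s,t,w)^2=r(s)\left(r(s)+2a_1(s,t,w)r'(s)\right)$. Furthermore, the canal hypersurfaces that are formed as the envelope of a family of pseudo hyperbolic hyperspheres with radius function $r(s)$ whose centers lie on $\gamma(s)$ can be parametrized by $$C_2(s,t,w)=\gamma(s)+a_1(s,t,w)F_1(s)+a_2(s,t,w)F_2(s)+r(s)r'(s)F_3(s)+a_4(s,t,w)F_4(s),$$ where $a_2(s,t,w)^2+a_4(s,t,w)^2=-r(s)\left(r(s)+2a_1(s,t,w)r'(s)\right)$.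
   Context: $E_1^4$ is $\mathbb{R}^4$ with $\langle u,v\rangle=-u_1v_1+u_2v_2+u_3v_3+u_4v_4$. A null curve is a curve $\gamma(s)$ with all velocity vectors null (parametrized so that $\langle\gamma'',\gamma''\rangle=1$ when it is not a straight line); it has a Frenet frame $F_1=\gamma',F_2,F_3,F_4$ with $\langle F_2,F_2\rangle=\langle F_4,F_4\rangle=\langle F_1,F_3\rangle=1$, all other products $\langle F_i,F_j\rangle$ zero, and $F_1'=k_1F_2$, $F_2'=k_2F_1-k_1F_3$, $F_3'=-k_2F_2+k_3F_4$, $F_4'=-k_3F_1$, where $k_1=0$ if $\gamma$ is a straight line and $k_1=1$ otherwise. The pseudo hypersphere (resp. pseudo hyperbolic hypersphere) with center $p$ and radius $r>0$ is $\{u:\langle u-p,u-p\rangle=r^2\}$ (resp. $\{u:\langle u-p,u-p\rangle=-r^2\}$). With $\lambda=1$ for pseudo hyperspheres and $\lambda=-1$ for pseudo hyperbolic hyperspheres, a hypersurface $C(s,t,w)$ is (formed as) the envelope of the family with centers $\gamma(s)$ and radius function $r(s)>0$ if $\langle C-\gamma,C-\gamma\rangle=\lambda r^2$ and $C(s,t,w)-\gamma(s)$ is normal to the hypersurface (in particular $\langle C-\gamma,\partial C/\partial s\rangle=0$). The $a_i(s,t,w)$ are differentiable real functions, and $r'=dr/ds$. *)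

theory Defs
  imports "HOL-Analysis.Analysis"
begin

text \<open>Minkowski space \<open>E\<^sub>1\<^sup>4\<close> is the type \<^typ>\<open>real^4\<close> together with the following
  indefinite product of signature \<open>(-,+,+,+)\<close>.\<close>

definition mink :: "real^4 \<Rightarrow> real^4 \<Rightarrow> real" where
  "mink u v = - (u$1 * v$1) + u$2 * v$2 + u$3 * v$3 + u$4 * v$4"

text \<open>The zero vector is not counted as null.\<close>

definition null_vector :: "real^4 \<Rightarrow> bool" where
  "null_vector v \<longleftrightarrow> v \<noteq> 0 \<and> mink v v = 0"

definition pseudo_hypersphere :: "real^4 \<Rightarrow> real \<Rightarrow> (real^4) set" where
  "pseudo_hypersphere p \<rho> = {u. mink (u - p) (u - p) = \<rho>\<^sup>2}"

definition pseudo_hyperbolic_hypersphere :: "real^4 \<Rightarrow> real \<Rightarrow> (real^4) set" where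
  "pseudo_hyperbolic_hypersphere p \<rho> = {u. mink (u - p) (u - p) = - \<rho>\<^sup>2}"

definition straight_line_on :: "real set \<Rightarrow> (real \<Rightarrow> real^4) \<Rightarrow> bool" where
  "straight_line_on I \<gamma> \<longleftrightarrow> (\<exists>p v. \<forall>s\<in>I. \<exists>c. \<gamma> s = p + c *\<^sub>R v)"

definition null_curve :: "real set \<Rightarrow> (real \<Rightarrow> real^4) \<Rightarrow> bool" where
  "null_curve I \<gamma> \<longleftrightarrow>
     open I \<and> is_interval I \<and>
     (\<forall>s\<in>I. \<gamma> differentiable (at s) \<and>
            (\<lambda>u. vector_derivative \<gamma> (at u)) differentiable (at s) \<and>
            null_vector (vector_derivative \<gamma> (at s))) \<and>
     (\<not> straight_line_on I \<gamma> \<longrightarrow>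
        (\<forall>s\<in>I. let a = vector_derivative (\<lambda>u. vector_derivative \<gamma> (at u)) (at s)
               in mink a a = 1))"

text \<open>The curvature \<open>k\<^sub>1\<close> is a constant, 0 or 1, depending on the curve as a whole.\<close>

definition frenet_frame ::
  "real set \<Rightarrow> (real \<Rightarrow> real^4) \<Rightarrow>
   (real \<Rightarrow> real^4) \<Rightarrow> (real \<Rightarrow> real^4) \<Rightarrow> (real \<Rightarrow> real^4) \<Rightarrow> (real \<Rightarrow> real^4) \<Rightarrow>
   real \<Rightarrow> (real \<Rightarrow> real) \<Rightarrow> (real \<Rightarrow> real) \<Rightarrow> bool" where
  "frenet_frame I \<gamma> F1 F2 F3 F4 k1 k2 k3 \<longleftrightarrow>
     k1 = (if straight_line_on I \<gamma> then 0 else 1) \<and>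
     (\<forall>s\<in>I.
        mink (F2 s) (F2 s) = 1 \<and> mink (F4 s) (F4 s) = 1 \<and> mink (F1 s) (F3 s) = 1 \<and>
        mink (F1 s) (F1 s) = 0 \<and> mink (F3 s) (F3 s) = 0 \<and>
        mink (F1 s) (F2 s) = 0 \<and> mink (F1 s) (F4 s) = 0 \<and>
        mink (F2 s) (F3 s) = 0 \<and> mink (F2 s) (F4 s) = 0 \<and> mink (F3 s) (F4 s) = 0 \<and>
        (\<gamma> has_vector_derivative F1 s) (at s) \<and>
        (F1 has_vector_derivative k1 *\<^sub>R F2 s) (at s) \<and>
        (F2 has_vector_derivative k2 s *\<^sub>R F1 s - k1 *\<^sub>R F3 s) (at s) \<and>
        (F3 has_vector_derivative - (k2 s *\<^sub>R F2 s) + k3 s *\<^sub>R F4 s) (at s) \<and>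
        (F4 has_vector_derivative - (k3 s *\<^sub>R F1 s)) (at s))"

text \<open>A hypersurface is given by a differentiable map of the parameters \<open>(s, t, w)\<close>, which
  range over an open set; immersivity is not required, so that singular points are allowed.\<close>

definition parametrized_hypersurface ::
  "(real \<times> real \<times> real) set \<Rightarrow> (real \<times> real \<times> real \<Rightarrow> real^4) \<Rightarrow> bool" where
  "parametrized_hypersurface D C \<longleftrightarrow> open D \<and> C differentiable_on D"

definition normal_at ::
  "(real \<times> real \<times> real \<Rightarrow> real^4) \<Rightarrow> real \<times> real \<times> real \<Rightarrow> real^4 \<Rightarrow> bool" where
  "normal_at C = (\<lambda>(s, t, w) n.
     mink n (vector_derivative (\<lambda>x. C (x, t, w)) (at s)) = 0 \<and>
     mink n (vector_derivative (\<lambda>x. C (s, x, w)) (at t)) = 0 \<and>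
     mink n (vector_derivative (\<lambda>x. C (s, t, x)) (at w)) = 0)"

text \<open>Here \<open>S s\<close> is the member of the family with center \<open>\<gamma> s\<close>. Along its contact with \<open>S s\<close>
  the hypersurface has the normal \<open>C (s, t, w) - \<gamma> s\<close> of \<open>S s\<close>.\<close>

definition envelope_of_family ::
  "(real \<times> real \<times> real) set \<Rightarrow> (real \<times> real \<times> real \<Rightarrow> real^4) \<Rightarrow>
   (real \<Rightarrow> real^4) \<Rightarrow> (real \<Rightarrow> (real^4) set) \<Rightarrow> bool" where
  "envelope_of_family D C \<gamma> S \<longleftrightarrow>
     (\<forall>(s, t, w)\<in>D. C (s, t, w) \<in> S s \<and> normal_at C (s, t, w) (C (s, t, w) - \<gamma> s))"

end

theory Submission
  imports Defs
begin

text \<open>Write \<open>X = C - \<gamma>\<close>, and let \<open>\<epsilon> = 1\<close> for pseudo hyperspheres and \<open>\<epsilon> = -1\<close> for pseudo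
  hyperbolic hyperspheres, so that contact with the family is the equation
  \<open>\<langle>X, X\<rangle> = \<epsilon> r\<^sup>2\<close>. Both halves of the theorem are the cases of one argument in \<open>\<epsilon>\<close>.

  Differentiating the contact equation along \<open>t\<close> and \<open>w\<close> gives \<open>\<langle>X, C\<^sub>t\<rangle> = \<langle>X, C\<^sub>w\<rangle> = 0\<close>, because
  center and radius depend on \<open>s\<close> only. Along \<open>s\<close> it gives
  \<open>\<langle>X, C\<^sub>s - F\<^sub>1\<rangle> = \<epsilon> r r'\<close>. So on a hypersurface that satisfies the contact equation,
  normality of \<open>X\<close> is equivalent to the single scalar condition \<open>\<langle>X, F\<^sub>1\<rangle> = - \<epsilon> r r'\<close>
  (\<open>normal_iff_of_contact\<close>).

  A pseudo-orthonormal frame is a basis whose dual basis with respect to the product is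
  \<open>F\<^sub>3, F\<^sub>2, F\<^sub>1, F\<^sub>4\<close> (\<open>pseudo_orthonormal_frame_expansion\<close>). Hence \<open>\<langle>X, F\<^sub>1\<rangle>\<close> is
  the coefficient of \<open>X\<close> at \<open>F\<^sub>3\<close>, which the scalar condition prescribes, and the
  contact equation, \<open>2 a\<^sub>1 a\<^sub>3 + a\<^sub>2\<^sup>2 + a\<^sub>4\<^sup>2 = \<epsilon> r\<^sup>2\<close> in coefficients, becomes the stated
  relation between the \<open>a\<^sub>i\<close>. The coefficients are products of \<open>X\<close> with frame vectors and
  therefore differentiable.\<close>

section \<open>The Minkowski product\<close>

lemma mink_commute: "mink u v = mink v u"
  by (simp add: mink_def mult.commute)

lemma bounded_bilinear_mink: "bounded_bilinear mink"
proof -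
  have "bilinear mink"
    unfolding bilinear_def mink_def
    by (auto intro!: linearI simp: algebra_simps)
  then show ?thesis
    by (simp add: bilinear_conv_bounded_bilinear)
qed

lemmas mink_bilinear_simps =
  bounded_bilinear.add_left[OF bounded_bilinear_mink]
  bounded_bilinear.add_right[OF bounded_bilinear_mink]
  bounded_bilinear.diff_left[OF bounded_bilinear_mink]
  bounded_bilinear.diff_right[OF bounded_bilinear_mink]
  bounded_bilinear.scaleR_left[OF bounded_bilinear_mink]
  bounded_bilinear.scaleR_right[OF bounded_bilinear_mink]

text \<open>The map \<open>S\<close> forming combinations of the frame has the left inverse \<open>T\<close> given by the products
  with the dual vectors. Both are endomorphisms of a space of finite dimension, so \<open>T\<close> is
  also a right inverse.\<close>

lemma pseudo_orthonormal_frame_expansion: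
  fixes f1 f2 f3 f4 x :: "real^4"
  assumes "mink f2 f2 = 1" "mink f4 f4 = 1" "mink f1 f3 = 1"
    and "mink f1 f1 = 0" "mink f3 f3 = 0" "mink f1 f2 = 0" "mink f1 f4 = 0"
    and "mink f2 f3 = 0" "mink f2 f4 = 0" "mink f3 f4 = 0"
  shows "x = mink x f3 *\<^sub>R f1 + mink x f2 *\<^sub>R f2 + mink x f1 *\<^sub>R f3 + mink x f4 *\<^sub>R f4"
proof -
  define S :: "real^4 \<Rightarrow> real^4"
    where "S c = c$1 *\<^sub>R f1 + c$2 *\<^sub>R f2 + c$3 *\<^sub>R f3 + c$4 *\<^sub>R f4" for c
  define T :: "real^4 \<Rightarrow> real^4"
    where "T v = vector [mink v f3, mink v f2, mink v f1, mink v f4]" for v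
  have vec4: "(vector [a, b, c, d] :: real^4) $ 1 = a" "(vector [a, b, c, d] :: real^4) $ 2 = b"
    "(vector [a, b, c, d] :: real^4) $ 3 = c" "(vector [a, b, c, d] :: real^4) $ 4 = d"
    for a b c d :: real
    by (simp_all add: vector_def)
  have "linear S"
    by (rule linearI) (simp_all add: S_def algebra_simps)
  moreover have "linear T"
    by (rule linearI) (simp_all add: T_def vec_eq_iff forall_4 vec4 mink_bilinear_simps)
  moreover have "T \<circ> S = id"
    using assms mink_commute[of f2 f1] mink_commute[of f3 f1] mink_commute[of f4 f1]
      mink_commute[of f3 f2] mink_commute[of f4 f2] mink_commute[of f4 f3]
    by (auto simp: fun_eq_iff T_def S_def vec_eq_iff forall_4 vec4 mink_bilinear_simps)
  ultimately have "S \<circ> T = id"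
    using linear_inverse_left by blast
  then have "S (T x) = x"
    by (simp add: fun_eq_iff)
  then show ?thesis
    by (simp add: S_def T_def vec4)
qed

lemma mink_pseudo_orthonormal_combination:
  fixes f1 f2 f3 f4 :: "real^4"
  assumes "mink f2 f2 = 1" "mink f4 f4 = 1" "mink f1 f3 = 1"
    and "mink f1 f1 = 0" "mink f3 f3 = 0" "mink f1 f2 = 0" "mink f1 f4 = 0"
    and "mink f2 f3 = 0" "mink f2 f4 = 0" "mink f3 f4 = 0"
  defines "x \<equiv> \<lambda>a b c d :: real. a *\<^sub>R f1 + b *\<^sub>R f2 + c *\<^sub>R f3 + d *\<^sub>R f4"
  shows "mink (x a b c d) (x a b c d) = 2 * a * c + b\<^sup>2 + d\<^sup>2"
    and "mink (x a b c d) f1 = c"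
  using assms(1-10) mink_commute[of f2 f1] mink_commute[of f3 f1] mink_commute[of f4 f1]
    mink_commute[of f3 f2] mink_commute[of f4 f2] mink_commute[of f4 f3]
  by (simp_all add: x_def mink_bilinear_simps power2_eq_square)

section \<open>Normality along a contact hypersurface\<close>

lemma mink_derivative_of_contact:
  fixes c g :: "real \<Rightarrow> real^4" and h :: "real \<Rightarrow> real"
  assumes c: "(c has_vector_derivative c') (at x)"
    and g: "(g has_vector_derivative g') (at x)"
    and h: "(h has_real_derivative h') (at x)"
    and contact: "\<forall>\<^sub>F y in nhds x. mink (c y - g y) (c y - g y) = h y"
  shows "2 * mink (c x - g x) (c' - g') = h'"
proof -
  have X: "((\<lambda>y. c y - g y) has_vector_derivative (c' - g')) (at x)"
    by (rule has_vector_derivative_diff[OF c g])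
  have "((\<lambda>y. mink (c y - g y) (c y - g y)) has_vector_derivative
      (mink (c x - g x) (c' - g') + mink (c' - g') (c x - g x))) (at x)"
    by (rule bounded_bilinear.has_vector_derivative[OF bounded_bilinear_mink X X])
  then have "((\<lambda>y. mink (c y - g y) (c y - g y)) has_real_derivative
      (2 * mink (c x - g x) (c' - g'))) (at x)"
    by (simp add: has_real_derivative_iff_has_vector_derivative mink_commute[of "c' - g'"])
  moreover have "((\<lambda>y. mink (c y - g y) (c y - g y)) has_real_derivative h') (at x)"
    using DERIV_cong_ev[OF refl contact refl] h by blast
  ultimately show ?thesis
    by (rule DERIV_unique)
qed

text \<open>The three parameter lines through a point of the domain are instances of the curve \<open>\<phi>\<close>, so
  this serves all partial derivatives of \<open>C\<close>.\<close>

lemma hypersurface_along_curve: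
  fixes C :: "real \<times> real \<times> real \<Rightarrow> real^4" and \<phi> :: "real \<Rightarrow> real \<times> real \<times> real"
  assumes hyp: "parametrized_hypersurface D C"
    and \<phi>: "\<phi> differentiable (at x)" and x: "\<phi> x \<in> D"
  shows "((\<lambda>y. C (\<phi> y)) has_vector_derivative vector_derivative (\<lambda>y. C (\<phi> y)) (at x)) (at x)"
    and "\<forall>\<^sub>F y in nhds x. \<phi> y \<in> D"
proof -
  have "open D" and "C differentiable_on D"
    using hyp by (auto simp: parametrized_hypersurface_def)
  then have "C differentiable (at (\<phi> x))"
    using x differentiable_on_eq_differentiable_at by blast
  then have "(C \<circ> \<phi>) differentiable (at x)"
    by (rule differentiable_chain_at[OF \<phi>])
  then show "((\<lambda>y. C (\<phi> y)) has_vector_derivative vector_derivative (\<lambda>y. C (\<phi> y)) (at x)) (at x)"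
    by (simp add: o_def vector_derivative_works)
  have "isCont \<phi> x"
    using \<phi> by (rule differentiable_imp_continuous_within)
  then have "filterlim \<phi> (nhds (\<phi> x)) (nhds x)"
    by (simp add: continuous_at tendsto_at_iff_tendsto_nhds)
  then show "\<forall>\<^sub>F y in nhds x. \<phi> y \<in> D"
    using \<open>open D\<close> x by (rule topological_tendstoD)
qed

text \<open>The condition on the tangent directions \<open>C\<^sub>t\<close> and \<open>C\<^sub>w\<close> follows from contact alone, as the
  right side of the contact equation is constant along them; only \<open>C\<^sub>s\<close> leaves a condition.\<close>

lemma normal_iff_of_contact:
  fixes \<gamma> :: "real \<Rightarrow> real^4" and r :: "real \<Rightarrow> real"
  assumes hyp: "parametrized_hypersurface D C"
    and contact: "\<And>s t w. (s, t, w) \<in> D \<Longrightarrow>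
      mink (C (s, t, w) - \<gamma> s) (C (s, t, w) - \<gamma> s) = \<epsilon> * (r s)\<^sup>2"
    and p: "(s, t, w) \<in> D"
    and \<gamma>: "(\<gamma> has_vector_derivative v) (at s)"
    and r: "(r has_real_derivative r') (at s)"
  shows "normal_at C (s, t, w) (C (s, t, w) - \<gamma> s) \<longleftrightarrow>
    mink (C (s, t, w) - \<gamma> s) v = - (\<epsilon> * (r s * r'))"
proof -
  let ?X = "C (s, t, w) - \<gamma> s"
  let ?Cs = "vector_derivative (\<lambda>x. C (x, t, w)) (at s)"
  let ?Ct = "vector_derivative (\<lambda>x. C (s, x, w)) (at t)"
  let ?Cw = "vector_derivative (\<lambda>x. C (s, t, x)) (at w)"
  have s: "2 * mink ?X (?Cs - v) = \<epsilon> * (2 * r s * r')"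
  proof (rule mink_derivative_of_contact[where c = "\<lambda>x. C (x, t, w)" and g = \<gamma>
        and h = "\<lambda>y. \<epsilon> * (r y)\<^sup>2"])
    have line: "(\<lambda>x. (x, t, w)) differentiable (at s)"
      by simp
    note along = hypersurface_along_curve[OF hyp, where \<phi> = "\<lambda>x. (x, t, w)", OF line p]
    show "((\<lambda>x. C (x, t, w)) has_vector_derivative ?Cs) (at s)"
      by (rule along(1))
    show "\<forall>\<^sub>F y in nhds s. mink (C (y, t, w) - \<gamma> y) (C (y, t, w) - \<gamma> y) = \<epsilon> * (r y)\<^sup>2"
      using along(2) by eventually_elim (rule contact)
    show "((\<lambda>y. \<epsilon> * (r y)\<^sup>2) has_real_derivative \<epsilon> * (2 * r s * r')) (at s)"
      using DERIV_cmult[OF DERIV_power[OF r, of 2], of \<epsilon>] by (simp add: mult_ac)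
  qed (rule \<gamma>)
  have t: "2 * mink ?X (?Ct - 0) = 0"
  proof (rule mink_derivative_of_contact[where c = "\<lambda>x. C (s, x, w)" and g = "\<lambda>_. \<gamma> s"
        and h = "\<lambda>_. \<epsilon> * (r s)\<^sup>2"])
    have line: "(\<lambda>x. (s, x, w)) differentiable (at t)"
      by simp
    note along = hypersurface_along_curve[OF hyp, where \<phi> = "\<lambda>x. (s, x, w)", OF line p]
    show "((\<lambda>x. C (s, x, w)) has_vector_derivative ?Ct) (at t)"
      by (rule along(1))
    show "\<forall>\<^sub>F y in nhds t. mink (C (s, y, w) - \<gamma> s) (C (s, y, w) - \<gamma> s) = \<epsilon> * (r s)\<^sup>2"
      using along(2) by eventually_elim (rule contact)
  qed simp_all
  have w: "2 * mink ?X (?Cw - 0) = 0"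
  proof (rule mink_derivative_of_contact[where c = "\<lambda>x. C (s, t, x)" and g = "\<lambda>_. \<gamma> s"
        and h = "\<lambda>_. \<epsilon> * (r s)\<^sup>2"])
    have line: "(\<lambda>x. (s, t, x)) differentiable (at w)"
      by simp
    note along = hypersurface_along_curve[OF hyp, where \<phi> = "\<lambda>x. (s, t, x)", OF line p]
    show "((\<lambda>x. C (s, t, x)) has_vector_derivative ?Cw) (at w)"
      by (rule along(1))
    show "\<forall>\<^sub>F y in nhds w. mink (C (s, t, y) - \<gamma> s) (C (s, t, y) - \<gamma> s) = \<epsilon> * (r s)\<^sup>2"
      using along(2) by eventually_elim (rule contact)
  qed simp_all
  have "mink ?X ?Cs = mink ?X v + \<epsilon> * (r s * r')"
    using s mink_bilinear_simps(4)[of ?X ?Cs v] by (simp add: mult_ac)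
  moreover have "mink ?X ?Ct = 0" "mink ?X ?Cw = 0"
    using t w by simp_all
  ultimately show ?thesis
    unfolding normal_at_def prod.case by (simp only: simp_thms add_eq_0_iff2)
qed

section \<open>Envelopes along a null curve\<close>

text \<open>The parameter \<open>\<epsilon>\<close> covers both families: \<open>\<epsilon> = 1\<close> gives pseudo hyperspheres and
  \<open>\<epsilon> = - 1\<close> pseudo hyperbolic hyperspheres. The coefficients \<open>a\<^sub>1, a\<^sub>2, a\<^sub>4\<close> come from the
  products of \<open>C - \<gamma>\<close> with \<open>F\<^sub>3, F\<^sub>2, F\<^sub>4\<close>, which shows that they are differentiable.\<close>

lemma envelope_along_null_curve_iff:
  fixes \<gamma> F1 F2 F3 F4 :: "real \<Rightarrow> real^4"
    and k2 k3 r :: "real \<Rightarrow> real"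
  assumes "open I"
    and frame: "frenet_frame I \<gamma> F1 F2 F3 F4 k1 k2 k3"
    and "r differentiable_on I"
    and hyp: "parametrized_hypersurface D C"
    and D: "\<And>s t w. (s, t, w) \<in> D \<Longrightarrow> s \<in> I"
  shows "envelope_of_family D C \<gamma> (\<lambda>s. {u. mink (u - \<gamma> s) (u - \<gamma> s) = \<epsilon> * (r s)\<^sup>2}) \<longleftrightarrow>
    (\<exists>a1 a2 a4 :: real \<times> real \<times> real \<Rightarrow> real.
       a1 differentiable_on D \<and> a2 differentiable_on D \<and> a4 differentiable_on D \<and>
       (\<forall>(s, t, w)\<in>D.
          C (s, t, w) = \<gamma> s + a1 (s, t, w) *\<^sub>R F1 s + a2 (s, t, w) *\<^sub>R F2 s
                        - (\<epsilon> * (r s * deriv r s)) *\<^sub>R F3 s + a4 (s, t, w) *\<^sub>R F4 s \<and>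
          (a2 (s, t, w))\<^sup>2 + (a4 (s, t, w))\<^sup>2
            = \<epsilon> * (r s * (r s + 2 * a1 (s, t, w) * deriv r s))))"
    (is "?envelope \<longleftrightarrow> (\<exists>a1 a2 a4. ?param a1 a2 a4)")
proof -
  have products: "mink (F2 s) (F2 s) = 1" "mink (F4 s) (F4 s) = 1" "mink (F1 s) (F3 s) = 1"
      "mink (F1 s) (F1 s) = 0" "mink (F3 s) (F3 s) = 0" "mink (F1 s) (F2 s) = 0"
      "mink (F1 s) (F4 s) = 0" "mink (F2 s) (F3 s) = 0" "mink (F2 s) (F4 s) = 0"
      "mink (F3 s) (F4 s) = 0" if "s \<in> I" for s
    using frame that by (simp_all add: frenet_frame_def)
  have \<gamma>': "(\<gamma> has_vector_derivative F1 s) (at s)" if "s \<in> I" for s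
    using frame that by (simp add: frenet_frame_def)
  have r': "(r has_real_derivative deriv r s) (at s)" if "s \<in> I" for s
  proof -
    have "r differentiable (at s)"
      using assms(1,3) that differentiable_on_eq_differentiable_at by blast
    then show ?thesis
      using DERIV_deriv_iff_real_differentiable by blast
  qed
  let ?contact = "\<lambda>s t w. mink (C (s, t, w) - \<gamma> s) (C (s, t, w) - \<gamma> s) = \<epsilon> * (r s)\<^sup>2"
  have envelope_iff: "?envelope \<longleftrightarrow> (\<forall>(s, t, w)\<in>D. ?contact s t w \<and>
      mink (C (s, t, w) - \<gamma> s) (F1 s) = - (\<epsilon> * (r s * deriv r s)))"
    (is "_ \<longleftrightarrow> ?scalar")
  proof (cases "\<forall>(s, t, w)\<in>D. ?contact s t w")
    case True
    then have "?contact s t w" if "(s, t, w) \<in> D" for s t w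
      using that by blast
    note normal_iff_of_contact[OF hyp this _ \<gamma>'[OF D] r'[OF D]]
    with True show ?thesis
      by (fastforce simp: envelope_of_family_def)
  next
    case False
    then show ?thesis
      by (fastforce simp: envelope_of_family_def)
  qed
  show ?thesis
    unfolding envelope_iff
  proof
    assume scalar: ?scalar
    define a where "a F p = mink (C p - \<gamma> (fst p)) (F (fst p))" for F and p :: "real \<times> real \<times> real"
    have differentiable_at_param: "(\<lambda>p. G (fst p)) differentiable (at p)"
      if "(G has_vector_derivative G') (at (fst p))" for G :: "real \<Rightarrow> real^4" and G'
        and p :: "real \<times> real \<times> real"
    proof -
      have "G differentiable (at (fst p))"
        using that by (auto simp: has_vector_derivative_def differentiable_def)
      moreover have "fst differentiable (at p)"
        by (rule bounded_linear_imp_differentiable[OF bounded_linear_fst])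
      ultimately show ?thesis
        using differentiable_chain_at[of fst p G] by (simp add: o_def)
    qed
    have a: "a F differentiable_on D"
      if "\<And>s. s \<in> I \<Longrightarrow> \<exists>F'. (F has_vector_derivative F') (at s)" for F
    proof (rule differentiable_at_imp_differentiable_on)
      fix p assume p: "p \<in> D"
      then have s: "fst p \<in> I"
        using D[of "fst p" "fst (snd p)" "snd (snd p)"] by simp
      have "C differentiable (at p)"
        using hyp p differentiable_on_eq_differentiable_at
        unfolding parametrized_hypersurface_def by blast
      then have "(\<lambda>p. C p - \<gamma> (fst p)) differentiable (at p)"
        using differentiable_at_param[of \<gamma>, OF \<gamma>'[OF s]] by (rule differentiable_diff)
      moreover have "(\<lambda>p. F (fst p)) differentiable (at p)"
        using that[OF s] differentiable_at_param[of F _ p] by blast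
      ultimately show "a F differentiable (at p)"
        using bounded_bilinear.FDERIV[OF bounded_bilinear_mink,
            of "\<lambda>p. C p - \<gamma> (fst p)" _ p UNIV "\<lambda>p. F (fst p)"]
        unfolding a_def[abs_def] differentiable_def by blast
    qed
    have "?param (a F3) (a F2) (a F4)"
    proof (intro conjI)
      show "a F3 differentiable_on D" "a F2 differentiable_on D" "a F4 differentiable_on D"
        using frame by (auto simp: frenet_frame_def intro!: a)
      show "\<forall>(s, t, w)\<in>D.
          C (s, t, w) = \<gamma> s + a F3 (s, t, w) *\<^sub>R F1 s + a F2 (s, t, w) *\<^sub>R F2 s
                        - (\<epsilon> * (r s * deriv r s)) *\<^sub>R F3 s + a F4 (s, t, w) *\<^sub>R F4 s \<and>
          (a F2 (s, t, w))\<^sup>2 + (a F4 (s, t, w))\<^sup>2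
            = \<epsilon> * (r s * (r s + 2 * a F3 (s, t, w) * deriv r s))"
      proof clarify
        fix s t w assume p: "(s, t, w) \<in> D"
        let ?X = "C (s, t, w) - \<gamma> s"
        \<comment> \<open>The coefficient at \<open>F\<^sub>3\<close> is the product with \<open>F\<^sub>1\<close>, which the scalar condition
          prescribes.\<close>
        have X: "?X = a F3 (s, t, w) *\<^sub>R F1 s + a F2 (s, t, w) *\<^sub>R F2 s
            + (- (\<epsilon> * (r s * deriv r s))) *\<^sub>R F3 s + a F4 (s, t, w) *\<^sub>R F4 s"
          using pseudo_orthonormal_frame_expansion[OF products[OF D[OF p]], of ?X] scalar p
          by (auto simp: a_def)
        have "\<epsilon> * (r s)\<^sup>2 = mink ?X ?X"
          using scalar p by auto
        also have "\<dots> = 2 * a F3 (s, t, w) * (- (\<epsilon> * (r s * deriv r s)))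
            + (a F2 (s, t, w))\<^sup>2 + (a F4 (s, t, w))\<^sup>2"
          unfolding X by (rule mink_pseudo_orthonormal_combination(1)[OF products[OF D[OF p]]])
        finally have "(a F2 (s, t, w))\<^sup>2 + (a F4 (s, t, w))\<^sup>2
            = \<epsilon> * (r s * (r s + 2 * a F3 (s, t, w) * deriv r s))"
          by (simp add: algebra_simps power2_eq_square)
        moreover have "C (s, t, w) = \<gamma> s + a F3 (s, t, w) *\<^sub>R F1 s + a F2 (s, t, w) *\<^sub>R F2 s
            - (\<epsilon> * (r s * deriv r s)) *\<^sub>R F3 s + a F4 (s, t, w) *\<^sub>R F4 s"
          using X by (simp add: algebra_simps)
        ultimately show "C (s, t, w) = \<gamma> s + a F3 (s, t, w) *\<^sub>R F1 s + a F2 (s, t, w) *\<^sub>R F2 s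
              - (\<epsilon> * (r s * deriv r s)) *\<^sub>R F3 s + a F4 (s, t, w) *\<^sub>R F4 s \<and>
            (a F2 (s, t, w))\<^sup>2 + (a F4 (s, t, w))\<^sup>2
              = \<epsilon> * (r s * (r s + 2 * a F3 (s, t, w) * deriv r s))"
          by blast
      qed
    qed
    then show "\<exists>a1 a2 a4. ?param a1 a2 a4"
      by blast
  next
    assume "\<exists>a1 a2 a4. ?param a1 a2 a4"
    then obtain a1 a2 a4 where param: "?param a1 a2 a4"
      by blast
    show ?scalar
    proof clarify
      fix s t w assume p: "(s, t, w) \<in> D"
      let ?X = "C (s, t, w) - \<gamma> s"
      have C: "C (s, t, w) = \<gamma> s + a1 (s, t, w) *\<^sub>R F1 s + a2 (s, t, w) *\<^sub>R F2 s
            - (\<epsilon> * (r s * deriv r s)) *\<^sub>R F3 s + a4 (s, t, w) *\<^sub>R F4 s"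
        and relation: "(a2 (s, t, w))\<^sup>2 + (a4 (s, t, w))\<^sup>2
            = \<epsilon> * (r s * (r s + 2 * a1 (s, t, w) * deriv r s))"
        using param p by auto
      have X: "?X = a1 (s, t, w) *\<^sub>R F1 s + a2 (s, t, w) *\<^sub>R F2 s
          + (- (\<epsilon> * (r s * deriv r s))) *\<^sub>R F3 s + a4 (s, t, w) *\<^sub>R F4 s"
        unfolding C by (simp add: algebra_simps)
      have "mink ?X ?X = 2 * a1 (s, t, w) * (- (\<epsilon> * (r s * deriv r s)))
          + (a2 (s, t, w))\<^sup>2 + (a4 (s, t, w))\<^sup>2"
        unfolding X by (rule mink_pseudo_orthonormal_combination(1)[OF products[OF D[OF p]]])
      also have "\<dots> = \<epsilon> * (r s)\<^sup>2"
        using relation by (simp add: algebra_simps power2_eq_square)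
      finally have "?contact s t w" .
      moreover have "mink ?X (F1 s) = - (\<epsilon> * (r s * deriv r s))"
        unfolding X by (rule mink_pseudo_orthonormal_combination(2)[OF products[OF D[OF p]]])
      ultimately show "?contact s t w \<and> mink ?X (F1 s) = - (\<epsilon> * (r s * deriv r s))"
        by blast
    qed
  qed
qed

theorem theorem5:
  fixes \<gamma> F1 F2 F3 F4 :: "real \<Rightarrow> real^4"
    and k1 :: real
    and k2 k3 r :: "real \<Rightarrow> real"
    and I :: "real set"
    and D :: "(real \<times> real \<times> real) set"
    and C :: "real \<times> real \<times> real \<Rightarrow> real^4"
  assumes "null_curve I \<gamma>"
    and "frenet_frame I \<gamma> F1 F2 F3 F4 k1 k2 k3"
    and "r differentiable_on I"
    and "\<forall>s\<in>I. r s > 0"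
    and "parametrized_hypersurface D C"
    and "\<forall>(s, t, w)\<in>D. s \<in> I"
  shows
    "(envelope_of_family D C \<gamma> (\<lambda>s. pseudo_hypersphere (\<gamma> s) (r s)) \<longleftrightarrow>
       (\<exists>a1 a2 a4 :: real \<times> real \<times> real \<Rightarrow> real.
          a1 differentiable_on D \<and> a2 differentiable_on D \<and> a4 differentiable_on D \<and>
          (\<forall>(s, t, w)\<in>D.
             C (s, t, w) = \<gamma> s + a1 (s, t, w) *\<^sub>R F1 s + a2 (s, t, w) *\<^sub>R F2 s
                           - (r s * deriv r s) *\<^sub>R F3 s + a4 (s, t, w) *\<^sub>R F4 s \<and>
             (a2 (s, t, w))\<^sup>2 + (a4 (s, t, w))\<^sup>2
               = r s * (r s + 2 * a1 (s, t, w) * deriv r s))))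
     \<and>
     (envelope_of_family D C \<gamma> (\<lambda>s. pseudo_hyperbolic_hypersphere (\<gamma> s) (r s)) \<longleftrightarrow>
       (\<exists>a1 a2 a4 :: real \<times> real \<times> real \<Rightarrow> real.
          a1 differentiable_on D \<and> a2 differentiable_on D \<and> a4 differentiable_on D \<and>
          (\<forall>(s, t, w)\<in>D.
             C (s, t, w) = \<gamma> s + a1 (s, t, w) *\<^sub>R F1 s + a2 (s, t, w) *\<^sub>R F2 s
                           + (r s * deriv r s) *\<^sub>R F3 s + a4 (s, t, w) *\<^sub>R F4 s \<and>
             (a2 (s, t, w))\<^sup>2 + (a4 (s, t, w))\<^sup>2
               = - (r s * (r s + 2 * a1 (s, t, w) * deriv r s)))))"
proof -
  have "open I"
    using assms(1) by (simp add: null_curve_def)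
  moreover have "s \<in> I" if "(s, t, w) \<in> D" for s t w
    using assms(6) that by blast
  ultimately show ?thesis
    using envelope_along_null_curve_iff[OF _ assms(2,3,5), where \<epsilon> = 1]
      envelope_along_null_curve_iff[OF _ assms(2,3,5), where \<epsilon> = "- 1"]
    by (simp add: pseudo_hypersphere_def pseudo_hyperbolic_hypersphere_def)
qed

end
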